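(* Let $n\ge1$ and let $\mathfrak g=\mathbb R e_0\ltimes\mathfrak h_{2n+1}$ be a unimodular extension of the Heisenberg Lie algebra $\mathfrak h_{2n+1}$, where $\operatorname{ad}_{e_0}$ acts on $\mathfrak h_{2n+1}$ by a derivation $D$ whose matrix in the basis $e_1,\dots,e_{2n+1}$ is $$\begin{pmatrix}A&0\\0&\lambda\end{pmatrix},\qquad A=(a_{ij})\in\mathfrak{gl}_{2n}(\mathbb R),\quad a_{i+1,i+1}=\lambda-a_{i,i}\ \text{ for } i=2k+1,\ k=0,\dots,n-1,$$ and suppose that $A\in\mathrm{GL}_{2n}(\mathbb R)$. Then $\mathfrak g$ does not admit a symplectic structure.
   Context: The Heisenberg Lie algebra $\mathfrak h_{2n+1}$ has basis $e_1,\dots,e_{2n+1}$ with nonzero brackets $[e_i,e_{i+1}]=e_{2n+1}$ for $i=2k+1$, $k=0,\dots,n-1$. A Lie algebra is unimodular if $\operatorname{tr}(\operatorname{ad}_x)=0$ for all $x$. A symplectic structure on a $2m$-dimensional Lie algebra is a closed (Chevalley–Eilenberg, trivial coefficients) 2-form $\omega$ with $\omega^m\neq0$. *)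

theory Defs
  imports
    "HOL-Analysis.Linear_Algebra"
    "HOL-Combinatorics.Permutations"
    "Jordan_Normal_Form.Matrix"
begin

text \<open>
  A real Lie algebra is a real vector space, given as a type, together with a bracket on it.
\<close>

definition lie_algebra :: "('a::real_vector \<Rightarrow> 'a \<Rightarrow> 'a) \<Rightarrow> bool" where
  "lie_algebra br \<longleftrightarrow>
     bilinear br \<and> (\<forall>x. br x x = 0) \<and>
     (\<forall>x y z. br x (br y z) + br y (br z x) + br z (br x y) = 0)"

definition lie_derivation :: "('a::real_vector \<Rightarrow> 'a \<Rightarrow> 'a) \<Rightarrow> ('a \<Rightarrow> 'a) \<Rightarrow> bool" where
  "lie_derivation br D \<longleftrightarrow> linear D \<and> (\<forall>x y. D (br x y) = br (D x) y + br x (D y))"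

text \<open>Bases \<open>e 1, \<dots>, e N\<close> are indexed from 1.\<close>

definition is_basis :: "nat \<Rightarrow> (nat \<Rightarrow> 'a::real_vector) \<Rightarrow> bool" where
  "is_basis N e \<longleftrightarrow>
     inj_on e {1..N} \<and> independent (e ` {1..N}) \<and> span (e ` {1..N}) = UNIV"

text \<open>
  The brackets with \<open>i \<ge> j\<close> are determined by antisymmetry.
\<close>

definition heisenberg ::
  "nat \<Rightarrow> ('a::real_vector \<Rightarrow> 'a \<Rightarrow> 'a) \<Rightarrow> (nat \<Rightarrow> 'a) \<Rightarrow> bool" where
  "heisenberg n br e \<longleftrightarrow>
     lie_algebra br \<and> is_basis (2*n + 1) e \<and>
     (\<forall>i j. 1 \<le> i \<and> i < j \<and> j \<le> 2*n + 1 \<longrightarrow>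
        br (e i) (e j) = (if (\<exists>k<n. i = 2*k + 1 \<and> j = i + 1) then e (2*n + 1) else 0))"

text \<open>
  Matrix entries are indexed from 0; column \<open>j - 1\<close> holds the coordinates of \<open>f (e j)\<close>.
\<close>

definition has_matrix ::
  "nat \<Rightarrow> (nat \<Rightarrow> 'a::real_vector) \<Rightarrow> ('a \<Rightarrow> 'a) \<Rightarrow> real mat \<Rightarrow> bool" where
  "has_matrix N e f M \<longleftrightarrow>
     M \<in> carrier_mat N N \<and>
     (\<forall>j\<in>{1..N}. f (e j) = (\<Sum>i = 1..N. M $$ (i - 1, j - 1) *\<^sub>R e i))"

text \<open>
  The semidirect product of the line spanned by \<open>e\<^sub>0 = (1, 0)\<close> with the Lie algebra \<open>br\<close>,
  in which \<open>e\<^sub>0\<close> acts by \<open>D\<close>.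
\<close>

definition semidirect_bracket ::
  "('a::real_vector \<Rightarrow> 'a \<Rightarrow> 'a) \<Rightarrow> ('a \<Rightarrow> 'a) \<Rightarrow> real \<times> 'a \<Rightarrow> real \<times> 'a \<Rightarrow> real \<times> 'a" where
  "semidirect_bracket br D u v =
     (0, fst u *\<^sub>R D (snd v) - fst v *\<^sub>R D (snd u) + br (snd u) (snd v))"

lemma lie_algebra_semidirect:
  assumes "lie_algebra br" and "lie_derivation br D"
  shows "lie_algebra (semidirect_bracket br D)"
proof -
  have bil: "bilinear br" and alt: "\<And>x. br x x = 0"
    and jac: "\<And>x y z. br x (br y z) + br y (br z x) + br z (br x y) = 0"
    using assms(1) by (auto simp: lie_algebra_def)
  have lin: "linear D" and der: "\<And>x y. D (br x y) = br (D x) y + br x (D y)"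
    using assms(2) by (auto simp: lie_derivation_def)
  note bs = bilinear_ladd[OF bil] bilinear_radd[OF bil] bilinear_lsub[OF bil]
    bilinear_rsub[OF bil] bilinear_lmul[OF bil] bilinear_rmul[OF bil]
    bilinear_lzero[OF bil] bilinear_rzero[OF bil]
  note ls = linear_add[OF lin] linear_diff[OF lin] linear_cmul[OF lin] linear_0[OF lin]
  have anti: "br x y = - br y x" for x y
    using alt[of "x + y"] alt[of x] alt[of y] by (simp add: bs eq_neg_iff_add_eq_0 add.commute)
  have "bilinear (semidirect_bracket br D)"
    unfolding bilinear_def
    by (auto intro!: linearI simp: semidirect_bracket_def bs ls algebra_simps)
  moreover have "semidirect_bracket br D u u = 0" for u
    by (simp add: semidirect_bracket_def alt zero_prod_def)
  moreover have "semidirect_bracket br D u (semidirect_bracket br D v w)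
      + semidirect_bracket br D v (semidirect_bracket br D w u)
      + semidirect_bracket br D w (semidirect_bracket br D u v) = 0" for u v w
  proof -
    obtain r x s y t z where uvw: "u = (r, x)" "v = (s, y)" "w = (t, z)"
      by (metis surj_pair)
    show ?thesis
      using jac[of x y z] anti[of y "D x"] anti[of z "D x"] anti[of z "D y"]
        anti[of x "D y"] anti[of x "D z"] anti[of y "D z"]
      by (simp add: uvw semidirect_bracket_def bs ls der zero_prod_def algebra_simps)
  qed
  ultimately show ?thesis by (simp add: lie_algebra_def)
qed

text \<open>
  The trace of an endomorphism of a finite-dimensional space, read off in some basis of the
  space; by the usual change-of-basis argument the choice of basis is irrelevant.
\<close>

definition endo_trace :: "('a::real_vector \<Rightarrow> 'a) \<Rightarrow> real" where
  "endo_trace f = (let B = extend_basis {} in \<Sum>b\<in>B. representation B (f b) b)"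

definition unimodular :: "('a::real_vector \<Rightarrow> 'a \<Rightarrow> 'a) \<Rightarrow> bool" where
  "unimodular br \<longleftrightarrow> (\<forall>x. endo_trace (br x) = 0)"

text \<open>
  A \<open>k\<close>-form is represented by a function on lists of vectors, of which only the
  values on lists of length \<open>k\<close> matter.
\<close>

definition alternating_form :: "nat \<Rightarrow> ('a::real_vector list \<Rightarrow> real) \<Rightarrow> bool" where
  "alternating_form k \<alpha> \<longleftrightarrow>
     (\<forall>xs i. length xs = k \<and> i < k \<longrightarrow> linear (\<lambda>x. \<alpha> (xs[i := x]))) \<and>
     (\<forall>xs i j. length xs = k \<and> i < j \<and> j < k \<and> xs ! i = xs ! j \<longrightarrow> \<alpha> xs = 0)"

text \<open>
  Chevalley--Eilenberg differential for trivial coefficients: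
  \<open>(d \<alpha>)(x\<^sub>0, \<dots>, x\<^sub>k)\<close> is the sum over \<open>i < j\<close> of \<open>(-1)\<^sup>i\<^sup>+\<^sup>j\<close> times \<open>\<alpha>\<close> evaluated at
  \<open>[x\<^sub>i, x\<^sub>j]\<close> followed by the remaining vectors in order.
\<close>

definition ce_differential ::
  "('a::real_vector \<Rightarrow> 'a \<Rightarrow> 'a) \<Rightarrow> ('a list \<Rightarrow> real) \<Rightarrow> 'a list \<Rightarrow> real" where
  "ce_differential br \<alpha> xs =
     (\<Sum>j<length xs. \<Sum>i<j. (-1) ^ (i + j) * \<alpha> (br (xs ! i) (xs ! j) # nths xs (- {i, j})))"

definition closed_form ::
  "('a::real_vector \<Rightarrow> 'a \<Rightarrow> 'a) \<Rightarrow> nat \<Rightarrow> ('a list \<Rightarrow> real) \<Rightarrow> bool" where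
  "closed_form br k \<alpha> \<longleftrightarrow> (\<forall>xs. length xs = k + 1 \<longrightarrow> ce_differential br \<alpha> xs = 0)"

definition wedge ::
  "nat \<Rightarrow> nat \<Rightarrow> ('a list \<Rightarrow> real) \<Rightarrow> ('a list \<Rightarrow> real) \<Rightarrow> 'a list \<Rightarrow> real" where
  "wedge p q \<alpha> \<beta> xs =
     (\<Sum>\<sigma> | \<sigma> permutes {..<p + q}.
        of_int (sign \<sigma>) * \<alpha> (take p (permute_list \<sigma> xs)) * \<beta> (drop p (permute_list \<sigma> xs)))
     / (fact p * fact q)"

text \<open>The \<open>m\<close>-th exterior power of a \<open>k\<close>-form, a \<open>(m k)\<close>-form.\<close>

primrec wedge_power :: "nat \<Rightarrow> ('a list \<Rightarrow> real) \<Rightarrow> nat \<Rightarrow> 'a list \<Rightarrow> real" where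
  "wedge_power k \<alpha> 0 = (\<lambda>_. 1)"
| "wedge_power k \<alpha> (Suc m) = wedge k (m * k) \<alpha> (wedge_power k \<alpha> m)"

definition symplectic_structure ::
  "('a::real_vector \<Rightarrow> 'a \<Rightarrow> 'a) \<Rightarrow> ('a list \<Rightarrow> real) \<Rightarrow> bool" where
  "symplectic_structure br \<omega> \<longleftrightarrow>
     alternating_form 2 \<omega> \<and> closed_form br 2 \<omega> \<and>
     (\<exists>m. (\<exists>b :: nat \<Rightarrow> 'a. is_basis (2 * m) b) \<and>
        (\<exists>xs. length xs = 2 * m \<and> wedge_power 2 \<omega> m xs \<noteq> 0))"

end

theory Submission
  imports Defs
begin

text \<open>
  Write \<open>z\<close> for the last basis vector of the Heisenberg algebra, \<open>V\<close> for the span of the others, with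
  \<open>p\<^sub>k = e\<^sub>2\<^sub>k\<^sub>+\<^sub>1\<close> and \<open>q\<^sub>k = e\<^sub>2\<^sub>k\<^sub>+\<^sub>2\<close> for \<open>k < n\<close>. A closed \<open>2\<close>-form \<open>\<omega>\<close> on the
  extension turns out to have \<open>z\<close> in its kernel, so that no top exterior power of it can survive.

  The trace of \<open>ad e\<^sub>0\<close> is \<open>(n + 1) \<lambda>\<close>, because each pair \<open>p\<^sub>k, q\<^sub>k\<close> contributes \<open>\<lambda>\<close> and so does
  \<open>z\<close>; unimodularity therefore forces \<open>\<lambda> = 0\<close>, and \<open>z\<close> is central in the whole extension. Closedness
  on \<open>e\<^sub>0, x, y\<close> then reads
  \<open>\<omega>(D x, y) + \<omega>(x, D y) + \<omega>([x, y], e\<^sub>0) = 0\<close> for \<open>x, y\<close> in the Heisenberg algebra, and this single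
  identity does everything.

  With \<open>y = z\<close> it says that \<open>z\<close> is orthogonal to the image of \<open>D\<close>, which is \<open>V\<close> as \<open>A\<close> is invertible.

  With \<open>x = p\<^sub>k, y = q\<^sub>k\<close>, summed over \<open>k\<close>, it computes \<open>n \<omega>(z, e\<^sub>0)\<close>. As \<open>D z = 0\<close>, the derivation
  \<open>D\<close> preserves the bracket pairing \<open>V \<times> V \<rightarrow> \<real> z\<close>, that is, \<open>A\<close> lies in the symplectic Lie algebra of
  that pairing. Hence it annihilates the dual bivector \<open>\<Sum>\<^sub>k p\<^sub>k \<and> q\<^sub>k\<close>, whose derivative along \<open>A\<close>,
  paired with \<open>\<omega>\<close>, is the remaining part of the sum
  (\<open>sum_hamiltonian_eq_0\<close>, \<open>derivation_sum_hamiltonian_eq_0\<close>). In matrices: if \<open>J\<close> is the pairing and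
  \<open>W\<close> the restriction of \<open>\<omega>\<close>, a multiple of the identity is the commutator of \<open>A\<close> and
  \<open>J\<^sup>-\<^sup>1 W\<close>, so it has trace \<open>0\<close>. Thus \<open>\<omega>(z, e\<^sub>0) = 0\<close>.

  That a nonzero kernel vector excludes a symplectic structure (\<open>not_symplectic_if_kernel\<close>) is
  multilinear algebra: exterior powers of an alternating form are alternating, they inherit
  its kernel, and an alternating form of top degree with nonzero kernel is zero.
\<close>

section \<open>Traces\<close>

lemma linear_coordinate:
  fixes B :: "'a::real_vector set"
  assumes "independent B" and "span B = UNIV"
  shows "linear (\<lambda>v. representation B v b)"
  using assms by (intro linearI) (simp_all add: representation_add representation_scale)

lemma linear_eq_0_on_basis:
  assumes e: "is_basis N e" and f: "linear f" and zero: "\<And>i. i \<in> {1..N} \<Longrightarrow> f (e i) = 0"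
  shows "f v = 0"
proof (rule linear_eq_0_on_span[OF f])
  show "v \<in> span (e ` {1..N})"
    using e by (simp add: is_basis_def)
qed (use zero in blast)

text \<open>
  The trace can be read off from any resolution \<open>v = \<Sum>\<^sub>i \<gamma>\<^sub>i(v) c\<^sub>i\<close> of the identity, since
  \<open>\<Sum>\<^sub>b \<beta>\<^sub>b(f b) = \<Sum>\<^sub>b \<Sum>\<^sub>i \<gamma>\<^sub>i(b) \<beta>\<^sub>b(f c\<^sub>i) = \<Sum>\<^sub>i \<gamma>\<^sub>i(\<Sum>\<^sub>b \<beta>\<^sub>b(f c\<^sub>i) b)\<close> for the coordinate functionals \<open>\<beta>\<^sub>b\<close> of
  the basis that defines the trace. For a product space such a resolution is assembled directly
  from resolutions of the factors.
\<close>

lemma endo_trace_eq_sum_frame: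
  fixes f :: "'a::real_vector \<Rightarrow> 'a"
  assumes fin: "finite I" and f: "linear f"
    and lin: "\<And>i. i \<in> I \<Longrightarrow> linear (\<gamma> i)"
    and frame: "\<And>v. v = (\<Sum>i\<in>I. \<gamma> i v *\<^sub>R c i)"
  shows "endo_trace f = (\<Sum>i\<in>I. \<gamma> i (f (c i)))"
proof -
  define B :: "'a set" where "B = extend_basis {}"
  have ind: "independent B" and sp: "span B = UNIV"
    using independent_extend_basis[of "{}"] span_extend_basis[of "{}"]
    by (auto simp: B_def independent_empty)
  have "v \<in> span (c ` I)" for v
  proof -
    have "(\<Sum>i\<in>I. \<gamma> i v *\<^sub>R c i) \<in> span (c ` I)"
      by (rule span_sum) (simp add: span_base span_scale)
    then show ?thesis
      by (simp only: frame[symmetric])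
  qed
  then have finB: "finite B"
    using independent_span_bound[of "c ` I" B] fin ind by auto
  let ?\<beta> = "\<lambda>b v. representation B v b"
  have lin\<beta>: "linear (?\<beta> b)" for b
    by (rule linear_coordinate[OF ind sp])
  have "?\<beta> b (f b) = (\<Sum>i\<in>I. \<gamma> i b * ?\<beta> b (f (c i)))" for b
  proof -
    have "f b = (\<Sum>i\<in>I. \<gamma> i b *\<^sub>R f (c i))"
      using arg_cong[OF frame[of b], of f] by (simp add: linear_sum[OF f] linear_cmul[OF f])
    then show ?thesis
      by (simp add: linear_sum[OF lin\<beta>] linear_cmul[OF lin\<beta>])
  qed
  then have "endo_trace f = (\<Sum>b\<in>B. \<Sum>i\<in>I. \<gamma> i b * ?\<beta> b (f (c i)))"
    by (simp add: endo_trace_def Let_def flip: B_def)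
  also have "\<dots> = (\<Sum>i\<in>I. \<Sum>b\<in>B. \<gamma> i b * ?\<beta> b (f (c i)))"
    by (rule sum.swap)
  also have "\<dots> = (\<Sum>i\<in>I. \<gamma> i (\<Sum>b\<in>B. ?\<beta> b (f (c i)) *\<^sub>R b))"
    by (rule sum.cong) (simp_all add: linear_sum[OF lin] linear_cmul[OF lin] mult.commute)
  also have "\<dots> = (\<Sum>i\<in>I. \<gamma> i (f (c i)))"
    by (simp add: sum_representation_eq[OF ind _ finB] sp)
  finally show ?thesis .
qed

text \<open>
  The line spanned by \<open>e\<^sub>0\<close> contributes nothing because \<open>[e\<^sub>0, e\<^sub>0] = 0\<close>; what is left is the trace
  of \<open>D\<close>.
\<close>

lemma endo_trace_semidirect:
  fixes e :: "nat \<Rightarrow> 'a::real_vector"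
  assumes br: "bilinear br" and D: "linear D" and e: "is_basis N e" and M: "has_matrix N e D M"
  shows "endo_trace (semidirect_bracket br D (1, 0)) = (\<Sum>j<N. M $$ (j, j))"
proof -
  let ?B = "e ` {1..N}"
  have inj: "inj_on e {1..N}" and ind: "independent ?B" and sp: "span ?B = UNIV"
    using e by (auto simp: is_basis_def)
  let ?\<beta> = "\<lambda>i v. representation ?B v (e i)"
  have lin\<beta>: "linear (?\<beta> i)" for i
    by (rule linear_coordinate[OF ind sp])
  have dual: "?\<beta> i (e j) = (if j = i then 1 else 0)" if "i \<in> {1..N}" "j \<in> {1..N}" for i j
    by (subst representation_basis[OF ind]) (use that inj in \<open>auto simp: inj_on_eq_iff\<close>)
  \<comment> \<open>Index \<open>0\<close>, free because the basis \<open>e\<close> starts at \<open>1\<close>, is given to \<open>e\<^sub>0\<close>.\<close>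
  define c :: "nat \<Rightarrow> real \<times> 'a" where "c i = (if i = 0 then (1, 0) else (0, e i))" for i
  define \<gamma> where "\<gamma> i u = (if i = 0 then fst u else ?\<beta> i (snd u))" for i and u :: "real \<times> 'a"
  have f: "linear (semidirect_bracket br D (1, 0))"
    by (rule linearI) (simp_all add: semidirect_bracket_def linear_add[OF D] linear_cmul[OF D]
        linear_0[OF D] bilinear_lzero[OF br])
  have split: "{0..N} = insert 0 {1..N}" by auto
  have "endo_trace (semidirect_bracket br D (1, 0))
      = (\<Sum>i\<in>{0..N}. \<gamma> i (semidirect_bracket br D (1, 0) (c i)))"
  proof (rule endo_trace_eq_sum_frame[OF _ f])
    show "linear (\<gamma> i)" for i
      by (rule linearI) (simp_all del: One_nat_def add: \<gamma>_def linear_add[OF lin\<beta>] linear_cmul[OF lin\<beta>])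
    fix u :: "real \<times> 'a"
    have "(\<Sum>i\<in>{1..N}. ?\<beta> i (snd u) *\<^sub>R e i) = (\<Sum>b\<in>?B. representation ?B (snd u) b *\<^sub>R b)"
      by (simp add: sum.reindex[OF inj] del: One_nat_def)
    also have "\<dots> = snd u"
      by (rule sum_representation_eq[OF ind]) (auto simp: sp simp del: One_nat_def)
    finally have "(\<Sum>i\<in>{1..N}. \<gamma> i u *\<^sub>R c i) = (0, snd u)"
      by (simp add: \<gamma>_def c_def sum_prod)
    then show "u = (\<Sum>i\<in>{0..N}. \<gamma> i u *\<^sub>R c i)"
      unfolding split by (simp add: \<gamma>_def c_def)
  qed simp
  also have "\<dots> = (\<Sum>i\<in>{1..N}. ?\<beta> i (D (e i)))"
    unfolding split
    by (simp add: \<gamma>_def c_def semidirect_bracket_def linear_0[OF D] bilinear_lzero[OF br])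
  also have "\<dots> = (\<Sum>i\<in>{1..N}. M $$ (i - 1, i - 1))"
  proof (rule sum.cong[OF refl])
    fix j assume j: "j \<in> {1..N}"
    have "?\<beta> j (D (e j)) = (\<Sum>i\<in>{1..N}. M $$ (i - 1, j - 1) * ?\<beta> j (e i))"
      using M j by (simp del: One_nat_def add: has_matrix_def linear_sum[OF lin\<beta>] linear_cmul[OF lin\<beta>])
    also have "\<dots> = (\<Sum>i\<in>{1..N}. if i = j then M $$ (j - 1, j - 1) else 0)"
      by (rule sum.cong) (use j dual in auto)
    finally show "?\<beta> j (D (e j)) = M $$ (j - 1, j - 1)"
      using j by simp
  qed
  also have "\<dots> = (\<Sum>j<N. M $$ (j, j))"
    by (rule sum.reindex_bij_witness[of _ Suc "\<lambda>i. i - 1"]) auto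
  finally show ?thesis .
qed

section \<open>Alternating forms\<close>

lemma alternating_form_linear:
  "\<lbrakk>alternating_form k \<alpha>; length xs = k; i < k\<rbrakk> \<Longrightarrow> linear (\<lambda>x. \<alpha> (xs[i := x]))"
  by (simp add: alternating_form_def)

lemma alternating_form_repeat:
  assumes "alternating_form k \<alpha>" "length xs = k" "i < k" "j < k" "i \<noteq> j" "xs ! i = xs ! j"
  shows "\<alpha> xs = 0"
  using assms unfolding alternating_form_def by (metis linorder_neqE_nat)

lemma permute_list_update:
  assumes \<sigma>: "\<sigma> permutes {..<length xs}" and i: "i < length xs"
  shows "permute_list \<sigma> (xs[i := x]) = (permute_list \<sigma> xs)[inv_into UNIV \<sigma> i := x]"
proof (rule nth_equalityI)
  fix l assume "l < length (permute_list \<sigma> (xs[i := x]))"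
  then have l: "l < length xs" by simp
  moreover have "\<sigma> l < length xs"
    using permutes_in_image[OF \<sigma>] l by simp
  moreover have "inv_into UNIV \<sigma> i < length xs"
    using permutes_in_image[OF permutes_inv[OF \<sigma>]] i by simp
  moreover have "inv_into UNIV \<sigma> i = l \<longleftrightarrow> \<sigma> l = i"
    using permutes_inv_eq[OF \<sigma>] by metis
  ultimately show "permute_list \<sigma> (xs[i := x]) ! l = (permute_list \<sigma> xs)[inv_into UNIV \<sigma> i := x] ! l"
    using \<sigma> i by (cases "\<sigma> l = i") (simp_all add: permute_list_nth)
qed simp

text \<open>
  In each summand, slot \<open>i\<close> is fed to exactly one of the two factors, which gives linearity.
  If the entries \<open>i\<close> and \<open>j\<close> coincide, composing \<open>\<sigma>\<close> with their transposition changes only the sign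
  of a summand, so the sum equals its own negative.
\<close>

lemma alternating_form_wedge:
  assumes \<alpha>: "alternating_form p \<alpha>" and \<beta>: "alternating_form q \<beta>"
  shows "alternating_form (p + q) (wedge p q \<alpha> \<beta>)"
proof -
  let ?F = "\<lambda>xs \<sigma>. of_int (sign \<sigma>) * \<alpha> (take p (permute_list \<sigma> xs)) * \<beta> (drop p (permute_list \<sigma> xs)) :: real"
  have "linear (\<lambda>x. wedge p q \<alpha> \<beta> (xs[i := x]))" if xs: "length xs = p + q" and i: "i < p + q" for xs i
  proof -
    have "linear (\<lambda>x. ?F (xs[i := x]) \<sigma>)" if \<sigma>: "\<sigma> permutes {..<p + q}" for \<sigma>
    proof -
      define j where "j = inv_into UNIV \<sigma> i"
      define ys where "ys = permute_list \<sigma> xs"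
      have j: "j < p + q"
        using permutes_in_image[OF permutes_inv[OF \<sigma>]] i by (simp add: j_def)
      have ys: "length ys = p + q" by (simp add: ys_def xs)
      have perm: "permute_list \<sigma> (xs[i := x]) = ys[j := x]" for x
        using permute_list_update[of \<sigma> xs i x] \<sigma> xs i by (simp add: ys_def j_def)
      show ?thesis
      proof (cases "j < p")
        case True
        have "linear (\<lambda>x. \<alpha> ((take p ys)[j := x]))"
          by (rule alternating_form_linear[OF \<alpha>]) (use True ys in auto)
        from linear_add[OF this] linear_cmul[OF this] show ?thesis
          using True by (intro linearI) (simp_all add: perm take_update_swap algebra_simps)
      next
        case False
        have "linear (\<lambda>x. \<beta> ((drop p ys)[j - p := x]))"
          by (rule alternating_form_linear[OF \<beta>]) (use False j ys in auto)
        from linear_add[OF this] linear_cmul[OF this] show ?thesis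
          using False by (intro linearI) (simp_all add: perm drop_update_swap algebra_simps)
      qed
    qed
    then have lin: "linear (\<lambda>x. \<Sum>\<sigma> | \<sigma> permutes {..<p + q}. ?F (xs[i := x]) \<sigma>)"
      by (intro linear_compose_sum) auto
    show ?thesis
      unfolding wedge_def using linear_add[OF lin] linear_cmul[OF lin]
      by (intro linearI) (simp_all only: add_divide_distrib times_divide_eq_right real_scaleR_def)
  qed
  moreover have "wedge p q \<alpha> \<beta> xs = 0"
    if xs: "length xs = p + q" and ij: "i < j" "j < p + q" and eq: "xs ! i = xs ! j" for xs i j
  proof -
    let ?\<tau> = "transpose i j"
    have \<tau>: "?\<tau> permutes {..<p + q}"
      using ij by (auto intro: permutes_swap_id)
    have "permute_list ?\<tau> xs = xs"
      by (rule nth_equalityI) (use \<tau> xs eq in \<open>auto simp: permute_list_nth transpose_def\<close>)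
    then have perm: "permute_list (?\<tau> \<circ> \<sigma>) xs = permute_list \<sigma> xs" if "\<sigma> permutes {..<p + q}" for \<sigma>
      using permute_list_compose[of \<sigma> xs ?\<tau>] that xs by simp
    have sgn: "sign (?\<tau> \<circ> \<sigma>) = - sign \<sigma>" if "\<sigma> permutes {..<p + q}" for \<sigma>
      using sign_compose[of ?\<tau> \<sigma>] permutes_imp_permutation[OF _ \<tau>]
        permutes_imp_permutation[OF _ that] ij by (simp add: sign_swap_id)
    have "(\<Sum>\<sigma> | \<sigma> permutes {..<p + q}. ?F xs \<sigma>) = (\<Sum>\<sigma> | \<sigma> permutes {..<p + q}. - ?F xs \<sigma>)"
      by (rule sum.reindex_bij_witness[of _ "\<lambda>\<sigma>. ?\<tau> \<circ> \<sigma>" "\<lambda>\<sigma>. ?\<tau> \<circ> \<sigma>"])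
        (auto simp: perm sgn o_assoc intro: permutes_compose[OF _ \<tau>])
    then show ?thesis
      by (simp add: wedge_def sum_negf)
  qed
  ultimately show ?thesis
    unfolding alternating_form_def by blast
qed

lemma alternating_form_wedge_power:
  "alternating_form k \<alpha> \<Longrightarrow> alternating_form (m * k) (wedge_power k \<alpha> m)"
  by (induction m) (simp_all add: alternating_form_wedge, simp add: alternating_form_def)

lemma wedge_eq_0_if_mem:
  assumes \<alpha>: "\<And>xs. length xs = p \<Longrightarrow> r \<in> set xs \<Longrightarrow> \<alpha> xs = 0"
    and \<beta>: "\<And>xs. length xs = q \<Longrightarrow> r \<in> set xs \<Longrightarrow> \<beta> xs = 0"
    and xs: "length xs = p + q" "r \<in> set xs"
  shows "wedge p q \<alpha> \<beta> xs = 0"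
proof -
  have "\<alpha> (take p (permute_list \<sigma> xs)) * \<beta> (drop p (permute_list \<sigma> xs)) = 0"
    if "\<sigma> permutes {..<p + q}" for \<sigma>
  proof -
    have "r \<in> set (permute_list \<sigma> xs)"
      using that xs by simp
    then have "r \<in> set (take p (permute_list \<sigma> xs)) \<or> r \<in> set (drop p (permute_list \<sigma> xs))"
      by (metis Un_iff append_take_drop_id set_append)
    then show ?thesis
      using \<alpha>[of "take p (permute_list \<sigma> xs)"] \<beta>[of "drop p (permute_list \<sigma> xs)"] xs by auto
  qed
  then have "(\<Sum>\<sigma> | \<sigma> permutes {..<p + q}. of_int (sign \<sigma>)
      * \<alpha> (take p (permute_list \<sigma> xs)) * \<beta> (drop p (permute_list \<sigma> xs))) = 0"
    by (intro sum.neutral) auto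
  then show ?thesis
    by (simp add: wedge_def)
qed

lemma wedge_power_eq_0_if_mem:
  assumes "\<And>xs. length xs = k \<Longrightarrow> r \<in> set xs \<Longrightarrow> \<alpha> xs = 0"
  shows "length xs = m * k \<Longrightarrow> r \<in> set xs \<Longrightarrow> wedge_power k \<alpha> m xs = 0"
proof (induction m arbitrary: xs)
  case (Suc m)
  then show ?case
    using wedge_eq_0_if_mem[of k r \<alpha> "m * k" "wedge_power k \<alpha> m" xs] assms by simp
qed simp

text \<open>
  The vector \<open>r\<close> and the \<open>k\<close> arguments are \<open>k + 1\<close> vectors in dimension \<open>k\<close>, hence satisfy a
  nontrivial linear relation, and as \<open>r \<noteq> 0\<close> some argument \<open>x\<^sub>i\<close> occurs in it. Replacing \<open>x\<^sub>i\<close> by the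
  combination of all arguments that the relation equates with a multiple of \<open>r\<close> gives zero on the
  one hand, and \<open>\<alpha>(x\<^sub>1, \<dots>, x\<^sub>k)\<close> times the coefficient of \<open>x\<^sub>i\<close> on the other.
\<close>

lemma top_form_eq_0_if_degenerate:
  fixes \<alpha> :: "'a::real_vector list \<Rightarrow> real" and b :: "nat \<Rightarrow> 'a"
  assumes b: "is_basis k b" and \<alpha>: "alternating_form k \<alpha>" and r: "r \<noteq> 0"
    and deg: "\<And>xs. length xs = k \<Longrightarrow> r \<in> set xs \<Longrightarrow> \<alpha> xs = 0"
    and xs: "length xs = k"
  shows "\<alpha> xs = 0"
proof (cases "r \<in> set xs \<or> \<not> distinct xs")
  case True
  then show ?thesis
    using deg xs alternating_form_repeat[OF \<alpha>] by (metis distinct_conv_nth)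
next
  case False
  then have rx: "r \<notin> set xs" and dist: "distinct xs" by auto
  let ?S = "insert r (set xs)"
  have "card ?S = k + 1"
    using rx dist xs by (simp add: distinct_card)
  moreover have "card (b ` {1..k}) \<le> k"
    using card_image_le[of "{1..k}" b] by simp
  ultimately have "dependent ?S"
    using independent_span_bound[of "b ` {1..k}" ?S] b by (auto simp: is_basis_def)
  then obtain u where nz: "\<exists>v\<in>?S. u v \<noteq> 0" and "(\<Sum>v\<in>?S. u v *\<^sub>R v) = 0"
    using dependent_finite[of ?S] by auto
  then have rel: "(\<Sum>v\<in>set xs. u v *\<^sub>R v) = - u r *\<^sub>R r"
    using rx by (simp add: add.commute eq_neg_iff_add_eq_0)
  have "\<exists>v\<in>set xs. u v \<noteq> 0"
  proof (rule ccontr)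
    assume "\<not> ?thesis"
    then show False using nz rel r by auto
  qed
  then obtain i where i: "i < k" "u (xs ! i) \<noteq> 0"
    using xs by (metis in_set_conv_nth)
  let ?g = "\<lambda>x. \<alpha> (xs[i := x])"
  have g: "linear ?g"
    by (rule alternating_form_linear[OF \<alpha> xs i(1)])
  have others: "?g v = 0" if v: "v \<in> set xs" "v \<noteq> xs ! i" for v
  proof -
    obtain j where j: "j < k" "v = xs ! j" "j \<noteq> i"
      using v xs by (metis in_set_conv_nth)
    then show ?thesis
      by (intro alternating_form_repeat[OF \<alpha>, of _ i j]) (use xs i in auto)
  qed
  have "?g (\<Sum>v\<in>set xs. u v *\<^sub>R v) = (\<Sum>v\<in>set xs. u v * ?g v)"
    by (simp add: linear_sum[OF g] linear_cmul[OF g])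
  also have "\<dots> = (\<Sum>v\<in>{xs ! i}. u v * ?g v)"
    by (rule sum.mono_neutral_right) (use others i xs in auto)
  also have "\<dots> = u (xs ! i) * \<alpha> xs"
    by simp
  finally have "u (xs ! i) * \<alpha> xs = - u r * ?g r"
    unfolding rel by (simp add: linear_cmul[OF g] linear_neg[OF g])
  also have "?g r = 0"
    by (rule deg) (use xs i in \<open>auto simp: set_update_memI\<close>)
  finally show ?thesis
    using i by simp
qed

lemma alternating_form_2:
  assumes \<omega>: "alternating_form 2 \<omega>"
  shows "bilinear (\<lambda>x y. \<omega> [x, y])" and "\<omega> [x, y] = - \<omega> [y, x]"
proof -
  have "linear (\<lambda>x. \<omega> [x, y])" and "linear (\<lambda>y. \<omega> [x, y])" for x y
    using alternating_form_linear[OF \<omega>, of "[x, y]" 0]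
      alternating_form_linear[OF \<omega>, of "[x, y]" 1] by simp_all
  then show bil: "bilinear (\<lambda>x y. \<omega> [x, y])"
    by (simp add: bilinear_def)
  have alt: "\<omega> [x, x] = 0" for x
    by (rule alternating_form_repeat[OF \<omega>, of _ 0 1]) auto
  show "\<omega> [x, y] = - \<omega> [y, x]"
    using alt[of "x + y"] alt[of x] alt[of y]
    by (simp add: bilinear_ladd[OF bil] bilinear_radd[OF bil])
qed

lemma not_symplectic_if_kernel:
  fixes r :: "'a::real_vector"
  assumes "r \<noteq> 0" and ker: "\<And>y. \<omega> [r, y] = 0"
  shows "\<not> symplectic_structure br \<omega>"
proof
  assume "symplectic_structure br \<omega>"
  then obtain m xs and b :: "nat \<Rightarrow> 'a" where \<omega>: "alternating_form 2 \<omega>" and b: "is_basis (2 * m) b"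
    and xs: "length xs = 2 * m" "wedge_power 2 \<omega> m xs \<noteq> 0"
    unfolding symplectic_structure_def by blast
  have "\<omega> ys = 0" if "length ys = 2" "r \<in> set ys" for ys
  proof -
    obtain x y where "ys = [x, y]"
      using \<open>length ys = 2\<close> by (auto simp: numeral_2_eq_2 length_Suc_conv)
    then show ?thesis
      using that ker alternating_form_2(2)[OF \<omega>, of x r] by auto
  qed
  then have "wedge_power 2 \<omega> m ys = 0" if "length ys = 2 * m" "r \<in> set ys" for ys
    using wedge_power_eq_0_if_mem[of 2 r \<omega> ys m] that by (simp add: mult.commute)
  moreover have "alternating_form (2 * m) (wedge_power 2 \<omega> m)"
    using alternating_form_wedge_power[OF \<omega>, of m] by (simp add: mult.commute)
  ultimately show False
    using top_form_eq_0_if_degenerate[OF b _ \<open>r \<noteq> 0\<close>] xs by blast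
qed

lemma closed_form_2_iff:
  "closed_form br 2 \<omega> \<longleftrightarrow> (\<forall>x y w. \<omega> [br x y, w] - \<omega> [br x w, y] + \<omega> [br y w, x] = 0)"
proof -
  have "ce_differential br \<omega> [x, y, w] = - \<omega> [br x y, w] + \<omega> [br x w, y] - \<omega> [br y w, x]" for x y w
    by (simp add: ce_differential_def numeral_3_eq_3 nths_Cons)
  moreover have "(\<forall>xs. length xs = 2 + 1 \<longrightarrow> P xs) \<longleftrightarrow> (\<forall>x y w. P [x, y, w])" for P :: "'a list \<Rightarrow> bool"
    by (auto simp: numeral_3_eq_3 length_Suc_conv)
  ultimately have "closed_form br 2 \<omega> \<longleftrightarrow>
      (\<forall>x y w. - \<omega> [br x y, w] + \<omega> [br x w, y] - \<omega> [br y w, x] = 0)"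
    by (simp only: closed_form_def)
  moreover have "- s + t - v = 0 \<longleftrightarrow> s - t + v = 0" for s t v :: real
    by linarith
  ultimately show ?thesis
    by (simp only:)
qed

section \<open>Derivations of the Heisenberg algebra\<close>

lemma sum_symmetric_skew_eq_0:
  fixes s w :: "nat \<Rightarrow> nat \<Rightarrow> real"
  assumes s: "\<And>k l. k < n \<Longrightarrow> l < n \<Longrightarrow> s k l = s l k" and w: "\<And>k l. w k l = - w l k"
  shows "(\<Sum>k<n. \<Sum>l<n. s k l * w k l) = 0"
proof -
  have "(\<Sum>k<n. \<Sum>l<n. s k l * w k l) = (\<Sum>l<n. \<Sum>k<n. s k l * w k l)"
    by (rule sum.swap)
  also have "\<dots> = (\<Sum>l<n. \<Sum>k<n. - (s l k * w l k))"
    by (intro sum.cong refl) (use s w in \<open>metis lessThan_iff mult_minus_right\<close>)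
  finally show ?thesis
    by (simp add: sum_negf)
qed

text \<open>
  The hypotheses on \<open>a, b, c, d\<close> say that \<open>D\<close> is in the Lie algebra of the symplectic group for the
  form with Darboux basis \<open>p, q\<close>: the off-diagonal blocks are symmetric and the diagonal ones are
  negative transposes of each other. The sum is \<open>W\<close> evaluated on the derivative along \<open>D\<close> of the
  bivector \<open>\<Sum>\<^sub>k p\<^sub>k \<and> q\<^sub>k\<close>. Expanded, the off-diagonal blocks pair a symmetric with a skew matrix and
  the diagonal blocks cancel.
\<close>

lemma sum_hamiltonian_eq_0:
  fixes W :: "'v::real_vector \<Rightarrow> 'v \<Rightarrow> real" and n :: nat
  assumes W: "bilinear W" and skew: "\<And>x y. W x y = - W y x"
    and Dp: "\<And>k. k < n \<Longrightarrow> D (p k) = (\<Sum>l<n. a k l *\<^sub>R p l + b k l *\<^sub>R q l)"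
    and Dq: "\<And>k. k < n \<Longrightarrow> D (q k) = (\<Sum>l<n. c k l *\<^sub>R p l + d k l *\<^sub>R q l)"
    and b: "\<And>k l. k < n \<Longrightarrow> l < n \<Longrightarrow> b k l = b l k"
    and c: "\<And>k l. k < n \<Longrightarrow> l < n \<Longrightarrow> c k l = c l k"
    and ad: "\<And>k l. k < n \<Longrightarrow> l < n \<Longrightarrow> d k l = - a l k"
  shows "(\<Sum>k<n. W (D (p k)) (q k) + W (p k) (D (q k))) = 0"
proof -
  have l: "linear (\<lambda>x. W x y)" and r: "linear (W x)" for x y
    using W by (auto simp: bilinear_def)
  note bil = linear_add[OF l] linear_add[OF r] linear_cmul[OF l] linear_cmul[OF r]
    linear_sum[OF l] linear_sum[OF r]
  have "(\<Sum>k<n. W (D (p k)) (q k) + W (p k) (D (q k)))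
      = (\<Sum>k<n. \<Sum>l<n. a k l * W (p l) (q k)) + (\<Sum>k<n. \<Sum>l<n. d k l * W (p k) (q l))
      + (\<Sum>k<n. \<Sum>l<n. b k l * W (q l) (q k)) + (\<Sum>k<n. \<Sum>l<n. c k l * W (p k) (p l))"
    by (simp add: Dp Dq bil sum.distrib)
  also have "(\<Sum>k<n. \<Sum>l<n. b k l * W (q l) (q k)) = 0"
    by (rule sum_symmetric_skew_eq_0) (rule b skew; assumption?)+
  also have "(\<Sum>k<n. \<Sum>l<n. c k l * W (p k) (p l)) = 0"
    by (rule sum_symmetric_skew_eq_0) (rule c skew; assumption?)+
  also have "(\<Sum>k<n. \<Sum>l<n. d k l * W (p k) (q l)) = - (\<Sum>k<n. \<Sum>l<n. a l k * W (p k) (q l))"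
    by (simp add: ad sum_negf)
  also have "(\<Sum>k<n. \<Sum>l<n. a l k * W (p k) (q l)) = (\<Sum>k<n. \<Sum>l<n. a k l * W (p l) (q k))"
    by (rule sum.swap)
  finally show ?thesis by simp
qed

lemma lie_algebra_skew:
  assumes "lie_algebra br"
  shows "br x y = - br y x"
proof -
  have bil: "bilinear br" and alt: "\<And>x. br x x = 0"
    using assms by (auto simp: lie_algebra_def)
  show ?thesis
    using alt[of "x + y"] alt[of x] alt[of y]
    by (simp add: bilinear_ladd[OF bil] bilinear_radd[OF bil] eq_neg_iff_add_eq_0 add.commute)
qed

text \<open>
  Applying \<open>D z = 0\<close> and the Leibniz rule to the brackets of two basis vectors, all of which are
  multiples of \<open>z\<close>, yields precisely the symmetry conditions on the blocks of \<open>D\<close>.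
\<close>

lemma derivation_sum_hamiltonian_eq_0:
  fixes W :: "'h::real_vector \<Rightarrow> 'h \<Rightarrow> real" and n :: nat
  assumes br: "lie_algebra br" and D: "lie_derivation br D" and z: "z \<noteq> 0" "D z = 0"
    and pp: "\<And>k l. k < n \<Longrightarrow> l < n \<Longrightarrow> br (p k) (p l) = 0"
    and qq: "\<And>k l. k < n \<Longrightarrow> l < n \<Longrightarrow> br (q k) (q l) = 0"
    and pq: "\<And>k l. k < n \<Longrightarrow> l < n \<Longrightarrow> br (p k) (q l) = (if l = k then z else 0)"
    and Dp: "\<And>k. k < n \<Longrightarrow> D (p k) = (\<Sum>l<n. a k l *\<^sub>R p l + b k l *\<^sub>R q l)"
    and Dq: "\<And>k. k < n \<Longrightarrow> D (q k) = (\<Sum>l<n. c k l *\<^sub>R p l + d k l *\<^sub>R q l)"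
    and W: "bilinear W" and skew: "\<And>x y. W x y = - W y x"
  shows "(\<Sum>k<n. W (D (p k)) (q k) + W (p k) (D (q k))) = 0"
proof -
  have bil: "bilinear br" and lin: "linear D"
    and der: "\<And>x y. D (br x y) = br (D x) y + br x (D y)"
    using br D by (auto simp: lie_algebra_def lie_derivation_def)
  have l: "linear (\<lambda>x. br x y)" and r: "linear (br x)" for x y
    using bil by (auto simp: bilinear_def)
  note bs = linear_add[OF l] linear_add[OF r] linear_cmul[OF l] linear_cmul[OF r]
    linear_sum[OF l] linear_sum[OF r]
  have qp: "br (q l) (p k) = (if l = k then - z else 0)" if "k < n" "l < n" for k l
    using pq[OF that] lie_algebra_skew[OF br, of "q l" "p k"] by auto
  have if_scale: "t *\<^sub>R (if P then v else 0) = (if P then t *\<^sub>R v else 0)" for t P and v :: 'h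
    by simp
  have Dpp: "br (D (p k)) (p l) = - b k l *\<^sub>R z" "br (p l) (D (p k)) = b k l *\<^sub>R z"
    and Dpq: "br (D (p k)) (q l) = a k l *\<^sub>R z" "br (q l) (D (p k)) = - a k l *\<^sub>R z"
    and Dqp: "br (D (q k)) (p l) = - d k l *\<^sub>R z" "br (p l) (D (q k)) = d k l *\<^sub>R z"
    and Dqq: "br (D (q k)) (q l) = c k l *\<^sub>R z" "br (q l) (D (q k)) = - c k l *\<^sub>R z"
    if "k < n" "l < n" for k l
    using that by (simp_all add: Dp Dq bs pp qq pq qp if_scale cong: if_cong)
  show ?thesis
  proof (rule sum_hamiltonian_eq_0[where D = D and a = a and b = b and c = c and d = d, OF W skew Dp Dq])
    fix k l assume kl: "k < n" "l < n"
    show "b k l = b l k"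
      using der[of "p k" "p l"] kl z by (simp add: pp Dpp linear_0[OF lin])
    show "c k l = c l k"
      using der[of "q k" "q l"] kl z by (simp add: qq Dqq linear_0[OF lin])
    have "D (br (p l) (q k)) = 0"
      using kl z by (simp add: pq linear_0[OF lin])
    then have "(a l k + d k l) *\<^sub>R z = 0"
      using der[of "p l" "q k"] kl by (simp add: Dpq Dqp scaleR_add_left)
    then show "d k l = - a l k"
      using z by simp
  qed
qed

lemma heisenberg_brackets:
  assumes H: "heisenberg n br e"
  shows "\<And>k l. k < n \<Longrightarrow> l < n \<Longrightarrow> br (e (2*k + 1)) (e (2*l + 1)) = 0"
    and "\<And>k l. k < n \<Longrightarrow> l < n \<Longrightarrow> br (e (2*k + 2)) (e (2*l + 2)) = 0"
    and "\<And>k l. k < n \<Longrightarrow> l < n \<Longrightarrow>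
      br (e (2*k + 1)) (e (2*l + 2)) = (if l = k then e (2*n + 1) else 0)"
    and "br x (e (2*n + 1)) = 0"
proof -
  have lie: "lie_algebra br" and e: "is_basis (2*n + 1) e"
    and br: "\<And>i j. 1 \<le> i \<Longrightarrow> i < j \<Longrightarrow> j \<le> 2*n + 1 \<Longrightarrow>
        br (e i) (e j) = (if (\<exists>k<n. i = 2*k + 1 \<and> j = i + 1) then e (2*n + 1) else 0)"
    using H by (auto simp: heisenberg_def)
  have bil: "bilinear br" and alt: "\<And>x. br x x = 0"
    using lie by (auto simp: lie_algebra_def)
  note skew = lie_algebra_skew[OF lie]
  \<comment> \<open>Only brackets with \<open>i < j\<close> are prescribed; skew symmetry gives a criterion free of order.\<close>
  have zero: "br (e i) (e j) = 0"
    if "1 \<le> i" "1 \<le> j" "i \<le> 2*n + 1" "j \<le> 2*n + 1"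
      and "\<nexists>k. k < n \<and> (i = 2*k + 1 \<and> j = i + 1 \<or> j = 2*k + 1 \<and> i = j + 1)" for i j
    using br[of i j] br[of j i] skew[of "e i" "e j"] alt that
    by (cases i j rule: linorder_cases) auto
  show "br (e (2*k + 1)) (e (2*l + 1)) = 0" if "k < n" "l < n" for k l
    by (rule zero) (use that in presburger)+
  show "br (e (2*k + 2)) (e (2*l + 2)) = 0" if "k < n" "l < n" for k l
    by (rule zero) (use that in presburger)+
  show "br (e (2*k + 1)) (e (2*l + 2)) = (if l = k then e (2*n + 1) else 0)" if kl: "k < n" "l < n" for k l
  proof (cases "l = k")
    case True
    then show ?thesis using br[of "2*k + 1" "2*l + 2"] kl by auto
  next
    case False
    have "br (e (2*k + 1)) (e (2*l + 2)) = 0"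
      by (rule zero) (use kl False in presburger)+
    with False show ?thesis by simp
  qed
  have "br (e i) (e (2*n + 1)) = 0" if "i \<in> {1..2*n + 1}" for i
    by (rule zero) (use that in \<open>simp_all, presburger?\<close>)
  then show "br x (e (2*n + 1)) = 0"
    using linear_eq_0_on_basis[OF e, of "\<lambda>x. br x (e (2*n + 1))" x] bil
    unfolding bilinear_def by blast
qed

lemma sum_lessThan_double:
  fixes f :: "nat \<Rightarrow> 'b::comm_monoid_add"
  shows "(\<Sum>i<2*n. f i) = (\<Sum>k<n. f (2*k) + f (2*k + 1))"
  by (induction n) (simp_all add: add.assoc)

lemma has_matrix_four_block:
  assumes A: "A \<in> carrier_mat m m"
    and M: "has_matrix (m + 1) e D (four_block_mat A (0\<^sub>m m 1) (0\<^sub>m 1 m) (mat 1 1 (\<lambda>_. lam)))"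
  shows "\<And>j. j < m \<Longrightarrow> D (e (j + 1)) = (\<Sum>i<m. A $$ (i, j) *\<^sub>R e (i + 1))"
    and "D (e (m + 1)) = lam *\<^sub>R e (m + 1)"
proof -
  let ?M = "four_block_mat A (0\<^sub>m m 1) (0\<^sub>m 1 m) (mat 1 1 (\<lambda>_. lam))"
  have D: "D (e (j + 1)) = (\<Sum>i<m. ?M $$ (i, j) *\<^sub>R e (i + 1)) + ?M $$ (m, j) *\<^sub>R e (m + 1)"
    if "j \<le> m" for j
  proof -
    have "D (e (j + 1)) = (\<Sum>i = 1..m + 1. ?M $$ (i - 1, j) *\<^sub>R e i)"
      using M that unfolding has_matrix_def by auto
    also have "\<dots> = (\<Sum>i<Suc m. ?M $$ (i, j) *\<^sub>R e (i + 1))"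
      by (rule sum.reindex_bij_witness[of _ Suc "\<lambda>i. i - 1"]) auto
    finally show ?thesis by simp
  qed
  show "D (e (j + 1)) = (\<Sum>i<m. A $$ (i, j) *\<^sub>R e (i + 1))" if "j < m" for j
    using D[of j] that A by simp
  show "D (e (m + 1)) = lam *\<^sub>R e (m + 1)"
    using D[of m] A by simp
qed

theorem proposition4p2:
  fixes n :: nat
    and br :: "'h::real_vector \<Rightarrow> 'h \<Rightarrow> 'h"
    and e :: "nat \<Rightarrow> 'h"
    and D :: "'h \<Rightarrow> 'h"
    and A :: "real mat"
    and lam :: real
  assumes "n \<ge> 1"
    and "heisenberg n br e"
    and "lie_derivation br D"
    and "A \<in> carrier_mat (2 * n) (2 * n)"
    and "has_matrix (2 * n + 1) e D
           (four_block_mat A (0\<^sub>m (2 * n) 1) (0\<^sub>m 1 (2 * n)) (mat 1 1 (\<lambda>_. lam)))"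
    and "\<And>k. k < n \<Longrightarrow> A $$ (2 * k + 1, 2 * k + 1) = lam - A $$ (2 * k, 2 * k)"
    and "unimodular (semidirect_bracket br D)"
    and "invertible_mat A"
  shows "\<not> (\<exists>\<omega>. symplectic_structure (semidirect_bracket br D) \<omega>)"
proof
  let ?m = "2 * n" and ?z = "e (2 * n + 1)" and ?g = "semidirect_bracket br D"
  let ?M = "four_block_mat A (0\<^sub>m ?m 1) (0\<^sub>m 1 ?m) (mat 1 1 (\<lambda>_. lam))"
  note A = assms(4) and M = assms(5)
  have lie: "lie_algebra br" and e: "is_basis (?m + 1) e"
    using assms(2) by (auto simp: heisenberg_def)
  have bil: "bilinear br" and lin: "linear D"
    using lie assms(3) by (auto simp: lie_algebra_def lie_derivation_def)
  note D = has_matrix_four_block[OF A M]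
  have "(\<Sum>j<?m + 1. ?M $$ (j, j)) = (\<Sum>j<?m. A $$ (j, j)) + lam"
    using A by simp
  also have "\<dots> = real n * lam + lam"
    using assms(6) by (simp add: sum_lessThan_double)
  finally have "real n * lam + lam = 0"
    using endo_trace_semidirect[OF bil lin e M] assms(7) by (simp add: unimodular_def)
  then have "(real n + 1) * lam = 0"
    by (simp add: algebra_simps)
  then have lam: "lam = 0"
    by simp
  have z: "?z \<noteq> 0"
    using e dependent_zero[of "e ` {1..?m + 1}"] by (force simp: is_basis_def)
  have Dz: "D ?z = 0"
    using D(2) lam by simp
  assume "\<exists>\<omega>. symplectic_structure ?g \<omega>"
  then obtain \<omega> where symp: "symplectic_structure ?g \<omega>" ..
  then have alt: "alternating_form 2 \<omega>" and "closed_form ?g 2 \<omega>"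
    by (auto simp: symplectic_structure_def)
  have closed: "\<omega> [?g x y, w] - \<omega> [?g x w, y] + \<omega> [?g y w, x] = 0" for x y w
    using \<open>closed_form ?g 2 \<omega>\<close> by (rule closed_form_2_iff[THEN iffD1, rule_format])
  note skew = alternating_form_2(2)[OF alt]
  have l: "linear (\<lambda>x. \<omega> [x, y])" and r: "linear (\<lambda>y. \<omega> [x, y])" for x y
    using alternating_form_2(1)[OF alt] by (simp_all only: bilinear_def)
  have zero_left: "\<omega> [0, y] = 0" for y
    using linear_0[OF l] .
  define W where "W x y = \<omega> [(0, x), (0, y)]" for x y
  have lin_W: "linear (W x)" for x
    unfolding W_def
  proof (rule linearI)
    fix y y' :: 'h and t :: real
    show "\<omega> [(0, x), (0, y + y')] = \<omega> [(0, x), (0, y)] + \<omega> [(0, x), (0, y')]"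
      using linear_add[OF r, of "(0, x)" "(0, y)" "(0, y')"] by simp
    show "\<omega> [(0, x), (0, t *\<^sub>R y)] = t *\<^sub>R \<omega> [(0, x), (0, y)]"
      using linear_cmul[OF r, of "(0, x)" t "(0, y)"] by simp
  qed
  have W_skew: "W x y = - W y x" for x y
    unfolding W_def by (rule skew)
  have W: "bilinear W"
    unfolding bilinear_def
  proof (intro conjI allI lin_W)
    fix y
    show "linear (\<lambda>x. W x y)"
      using linear_compose_neg[OF lin_W[of y]] by (subst W_skew)
  qed
  define c where "c = \<omega> [(0, ?z), (1, 0)]"
  have cocycle: "W (D x) y + W x (D y) + \<omega> [(0, br x y), (1, 0)] = 0" for x y
    using closed[of "(1, 0)" "(0, x)" "(0, y)"] W_skew[of x "D y"]
    by (simp add: semidirect_bracket_def W_def bilinear_lzero[OF bil] linear_0[OF lin])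

  \<comment> \<open>Summing the cocycle identity over the pairs \<open>p\<^sub>k, q\<^sub>k\<close> isolates \<open>n \<omega>(z, e\<^sub>0)\<close>.\<close>
  let ?p = "\<lambda>k. e (2*k + 1)" and ?q = "\<lambda>k. e (2*k + 2)"
  note br = heisenberg_brackets[OF assms(2)]
  have "(\<Sum>k<n. W (D (?p k)) (?q k) + W (?p k) (D (?q k))) = 0"
  proof (rule derivation_sum_hamiltonian_eq_0[OF lie assms(3) z Dz br(1-3) _ _ W W_skew])
    fix k assume k: "k < n"
    show "D (?p k) = (\<Sum>l<n. A $$ (2*l, 2*k) *\<^sub>R ?p l + A $$ (2*l + 1, 2*k) *\<^sub>R ?q l)"
      using D(1)[of "2*k"] k by (simp add: sum_lessThan_double)
    show "D (?q k) = (\<Sum>l<n. A $$ (2*l, 2*k + 1) *\<^sub>R ?p l + A $$ (2*l + 1, 2*k + 1) *\<^sub>R ?q l)"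
      using D(1)[of "2*k + 1"] k by (simp add: sum_lessThan_double)
  qed
  moreover have "W (D (?p k)) (?q k) + W (?p k) (D (?q k)) = - c" if "k < n" for k
    using cocycle[of "?p k" "?q k"] br(3)[OF that that] by (simp add: c_def)
  ultimately have c: "c = 0"
    using assms(1) by simp

  \<comment> \<open>As \<open>D z = 0\<close> and \<open>[x, z] = 0\<close>, the cocycle identity at \<open>y = z\<close> keeps only its first term.\<close>
  have WzD: "W ?z (D x) = 0" for x
    using cocycle[of x ?z] W_skew[of ?z "D x"] br(4)[of x] Dz zero_left linear_0[OF lin_W]
    by (simp add: zero_prod_def)
  have Wz: "W ?z (e (k + 1)) = 0" if k: "k < ?m" for k
  proof -
    \<comment> \<open>Column \<open>k\<close> of \<open>A\<^sup>-\<^sup>1\<close> writes \<open>e\<^sub>k\<^sub>+\<^sub>1\<close> as a combination of vectors in the image of \<open>D\<close>.\<close>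
    obtain B where AB: "inverts_mat A B" and BA: "inverts_mat B A"
      using assms(8) by (auto simp: invertible_mat_def)
    have B: "B \<in> carrier_mat ?m ?m" and AB1: "A * B = 1\<^sub>m ?m"
    proof -
      show AB1: "A * B = 1\<^sub>m ?m" using AB A by (simp add: inverts_mat_def)
      have "B * A = 1\<^sub>m (dim_row B)" using BA by (simp add: inverts_mat_def)
      then have "dim_row B = ?m" using A by (metis carrier_matD(2) index_mult_mat(3) index_one_mat(3))
      moreover have "dim_col B = ?m" using AB1 by (metis index_mult_mat(3) index_one_mat(3))
      ultimately show "B \<in> carrier_mat ?m ?m" by auto
    qed
    have entry: "(\<Sum>j<?m. A $$ (i, j) * B $$ (j, k)) = (if i = k then 1 else 0)" if "i < ?m" for i
    proof -
      have "(A * B) $$ (i, k) = (\<Sum>j<?m. A $$ (i, j) * B $$ (j, k))"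
        using A B that k by (simp add: scalar_prod_def atLeast0LessThan)
      then show ?thesis using AB1 that k by simp
    qed
    have "0 = (\<Sum>j<?m. B $$ (j, k) * W ?z (D (e (j + 1))))"
      by (simp add: WzD del: One_nat_def)
    also have "\<dots> = (\<Sum>j<?m. \<Sum>i<?m. A $$ (i, j) * B $$ (j, k) * W ?z (e (i + 1)))"
      using D(1) by (simp add: linear_sum[OF lin_W] linear_cmul[OF lin_W] sum_distrib_left ac_simps)
    also have "\<dots> = (\<Sum>i<?m. (\<Sum>j<?m. A $$ (i, j) * B $$ (j, k)) * W ?z (e (i + 1)))"
      by (subst sum.swap) (simp add: sum_distrib_right)
    also have "\<dots> = (\<Sum>i<?m. if i = k then W ?z (e (k + 1)) else 0)"
      by (rule sum.cong) (use entry in auto)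
    finally show ?thesis using k by simp
  qed
  have "W ?z (e i) = 0" if "i \<in> {1..?m + 1}" for i
    using that Wz[of "i - 1"] W_skew[of ?z ?z] by (cases "i = ?m + 1") auto
  then have Wz0: "W ?z v = 0" for v
    using linear_eq_0_on_basis[OF e lin_W[of ?z]] by blast
  have "\<omega> [(0, ?z), u] = 0" for u
  proof -
    have "u = fst u *\<^sub>R (1, 0) + (0, snd u)"
      by (simp add: prod_eq_iff)
    then have "\<omega> [(0, ?z), u] = fst u * c + W ?z (snd u)"
      using linear_add[OF r, of "(0, ?z)" "fst u *\<^sub>R (1, 0)" "(0, snd u)"]
        linear_cmul[OF r, of "(0, ?z)" "fst u" "(1, 0)"]
      by (simp add: c_def W_def)
    then show ?thesis
      using c Wz0 by simp
  qed
  moreover have "(0, ?z) \<noteq> (0 :: real \<times> 'h)"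
    using z by (simp add: zero_prod_def)
  ultimately show False
    using not_symplectic_if_kernel[of "(0, ?z)" \<omega>] symp by blast
qed

end
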